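(* Let $A$ be a $d\times d$ expansive integer matrix, $B$ a finite subset of $\mathbb{R}^d$, and let $\mu_B$ be the invariant measure associated to the affine iterated function system $\tau_b(x)=A^{-1}(x+b)$, $b\in B$, $x\in\mathbb{R}^d$. Assume: (a) The measure $\mu_B$ has spectrum $\Lambda\subset\mathbb{R}^d$. (b) For every $\lambda\in\Lambda$, $\hat\delta_B(x+\lambda)=\hat\delta_B(x)$ for all $x\in\mathbb{R}^d$. Then: (i) If the finite set $B$ is spectral with spectrum $(A^T)^{-1}L$ for some $L\subset\mathbb{R}^d$, then $A^T\Lambda\oplus L$ is also a spectrum for $\mu_B$ (in particular the sum $A^T\Lambda+L$ is direct). (ii) If there exists a set $L$ in $\mathbb{R}^d$ such that $A^T\Lambda\oplus L=\Lambda$, then $(A^T)^{-1}L$ is a spectrum for $B$.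
   Context: A matrix is expansive if all its eigenvalues have absolute value $>1$. For $\lambda\in\mathbb{R}^d$ let $e_\lambda(x)=e^{2\pi i\lambda\cdot x}$. A finite Borel measure $\mu$ on $\mathbb{R}^d$ has spectrum $\Lambda\subset\mathbb{R}^d$ if the family $(e_\lambda)_{\lambda\in\Lambda}$ is an orthogonal basis of $L^2(\mu)$; $\mu$ is spectral if it has a spectrum. For a finite set $B\subset\mathbb{R}^d$ put $\delta_B=\frac{1}{\#B}\sum_{b\in B}\delta_b$; a spectrum for $B$ is a spectrum for $\delta_B$, and $\hat\delta_B(x)=\frac{1}{\#B}\sum_{b\in B}e^{2\pi i b\cdot x}$. The invariant measure $\mu_B$ is the unique Borel probability measure on $\mathbb{R}^d$ such that $\int f\,d\mu_B=\frac{1}{\#B}\sum_{b\in B}\int f\circ\tau_b\,d\mu_B$ for all $f\in C_c(\mathbb{R}^d)$. The notation $P\oplus Q=R$ means $R=P+Q$ and every $r\in R$ can be written uniquely as $r=p+q$ with $p\in P$, $q\in Q$. *)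

theory Defs
  imports "HOL-Probability.Probability" "HOL-Library.Set_Algebras"
begin

definition integer_matrix :: "real^'n^'m \<Rightarrow> bool" where
  "integer_matrix A \<longleftrightarrow> (\<forall>i j. A $ i $ j \<in> \<int>)"

(* Eigenvalues are the complex ones, whence the complexified matrix. *)
definition expansive :: "real^'n^'n \<Rightarrow> bool" where
  "expansive A \<longleftrightarrow>
     (\<forall>(c::complex) (v::complex^'n). v \<noteq> 0 \<and> map_matrix complex_of_real A *v v = c *s v \<longrightarrow> norm c > 1)"

definition expo :: "real^'n \<Rightarrow> real^'n \<Rightarrow> complex" where
  "expo l x = exp (2 * complex_of_real pi * \<i> * complex_of_real (l \<bullet> x))"

(* The elements of the space L2 of a measure are represented by measurable functions. *)
definition square_integrable :: "'a measure \<Rightarrow> ('a \<Rightarrow> complex) \<Rightarrow> bool" where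
  "square_integrable M f \<longleftrightarrow> f \<in> borel_measurable M \<and> integrable M (\<lambda>x. (norm (f x))\<^sup>2)"

definition L2_inner :: "'a measure \<Rightarrow> ('a \<Rightarrow> complex) \<Rightarrow> ('a \<Rightarrow> complex) \<Rightarrow> complex" where
  "L2_inner M f g = (LINT x|M. f x * cnj (g x))"

definition L2_norm :: "'a measure \<Rightarrow> ('a \<Rightarrow> complex) \<Rightarrow> real" where
  "L2_norm M f = sqrt (LINT x|M. (norm (f x))\<^sup>2)"

(* Orthogonal basis in the Hilbert space sense: pairwise orthogonal nonzero vectors whose
   finite linear combinations are dense.  The family is indexed, so distinct indices
   must give orthogonal members even when these agree as functions. *)
definition orthogonal_basis_L2 :: "'a measure \<Rightarrow> 'i set \<Rightarrow> ('i \<Rightarrow> 'a \<Rightarrow> complex) \<Rightarrow> bool" where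
  "orthogonal_basis_L2 M I \<phi> \<longleftrightarrow>
     (\<forall>i\<in>I. square_integrable M (\<phi> i) \<and> L2_norm M (\<phi> i) \<noteq> 0) \<and>
     (\<forall>i\<in>I. \<forall>j\<in>I. i \<noteq> j \<longrightarrow> L2_inner M (\<phi> i) (\<phi> j) = 0) \<and>
     (\<forall>f. square_integrable M f \<longrightarrow>
        (\<forall>\<epsilon>>0. \<exists>S c. finite S \<and> S \<subseteq> I \<and>
           L2_norm M (\<lambda>x. f x - (\<Sum>i\<in>S. c i * \<phi> i x)) < \<epsilon>))"

definition has_spectrum :: "(real^'n) measure \<Rightarrow> (real^'n) set \<Rightarrow> bool" where
  "has_spectrum M \<Lambda> \<longleftrightarrow> orthogonal_basis_L2 M \<Lambda> expo"

(* The normalised counting measure of B, regarded as a Borel measure on the whole space. *)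
definition delta_measure :: "(real^'n) set \<Rightarrow> (real^'n) measure" where
  "delta_measure B = distr (uniform_count_measure B) borel (\<lambda>x. x)"

lemma emeasure_delta_measure:
  assumes "finite B" "E \<in> sets borel"
  shows "emeasure (delta_measure B) E = ennreal (card (B \<inter> E) / card B)"
proof -
  have "(\<lambda>x. x) -` E \<inter> B = B \<inter> E"
    by auto
  then show ?thesis
    using assms unfolding delta_measure_def
    by (subst emeasure_distr)
       (auto simp: space_uniform_count_measure emeasure_uniform_count_measure
             measurable_def sets_uniform_count_measure)
qed

definition delta_hat :: "(real^'n) set \<Rightarrow> real^'n \<Rightarrow> complex" where
  "delta_hat B x = 1 / of_nat (card B) * (\<Sum>b\<in>B. expo b x)"

definition ifs_map :: "real^'n^'n \<Rightarrow> real^'n \<Rightarrow> real^'n \<Rightarrow> real^'n" where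
  "ifs_map A b x = matrix_inv A *v (x + b)"

(* For expansive A and finite nonempty B exactly one measure satisfies this predicate;
   the integral identity cannot hold for B = {}. *)
definition invariant_measure :: "real^'n^'n \<Rightarrow> (real^'n) set \<Rightarrow> (real^'n) measure \<Rightarrow> bool" where
  "invariant_measure A B \<mu> \<longleftrightarrow>
     sets \<mu> = sets borel \<and> prob_space \<mu> \<and>
     (\<forall>f :: real^'n \<Rightarrow> complex.
        continuous_on UNIV f \<and> compact (closure {x. f x \<noteq> 0}) \<longrightarrow>
        (LINT x|\<mu>. f x) = 1 / of_nat (card B) * (\<Sum>b\<in>B. LINT x|\<mu>. f (ifs_map A b x)))"

definition is_direct_sum :: "'a::plus set \<Rightarrow> 'a set \<Rightarrow> 'a set \<Rightarrow> bool" where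
  "is_direct_sum P Q R \<longleftrightarrow>
     R = P + Q \<and> (\<forall>r\<in>R. \<exists>!z. z \<in> P \<times> Q \<and> r = fst z + snd z)"

end

theory Submission
  imports Defs
begin

text \<open>
  If the exponentials are total in \<open>L\<^sup>2(M)\<close>, then \<open>\<Lambda>\<close> is a spectrum of the probability measure
  \<open>M\<close> iff the squared moduli of the Fourier transform of \<open>M\<close> at \<open>y + l\<close>, \<open>l \<in> \<Lambda>\<close>, sum up to 1
  for every \<open>y\<close>.  Writing \<open>S\<close> for the transpose of \<open>A\<close>, invariance of \<open>\<mu>\<close> gives
  \<open>fourier \<mu> (S u) = delta_hat B u * fourier \<mu> u\<close>.  As \<open>delta_hat B\<close> is \<open>\<Lambda>\<close>-periodic, the sum
  for \<open>\<mu>\<close> over the points \<open>S k + l\<close>, with \<open>k \<in> \<Lambda>\<close> and \<open>l \<in> L\<close>, factors through the sum for \<open>B\<close>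
  over \<open>S\<^sup>-\<^sup>1 L\<close>, because the inner sum over \<open>\<Lambda>\<close> is 1.  Totality of the exponentials in
  \<open>L\<^sup>2(\<mu>)\<close> is part of hypothesis (a).
\<close>

section \<open>Exponentials and the Fourier transform of a measure\<close>

definition fourier :: "(real^'n) measure \<Rightarrow> real^'n \<Rightarrow> complex" where
  "fourier M y = (LINT x|M. expo y x)"

lemma expo_eq_cis: "expo l x = cis (2 * pi * (l \<bullet> x))"
  by (simp add: expo_def cis_conv_exp mult_ac)

lemma norm_expo [simp]: "norm (expo l x) = 1"
  by (simp add: expo_eq_cis)

lemma expo_commute: "expo l x = expo x l"
  by (simp add: expo_def inner_commute)

lemma expo_add_left: "expo (k + l) x = expo k x * expo l x"
  by (simp add: expo_eq_cis cis_mult inner_add_left algebra_simps)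

lemma expo_add_right: "expo l (x + y) = expo l x * expo l y"
  by (simp add: expo_eq_cis cis_mult inner_add_right algebra_simps)

lemma expo_zero_left [simp]: "expo 0 x = 1"
  by (simp add: expo_eq_cis)

lemma cnj_expo: "cnj (expo l x) = expo (- l) x"
  by (simp add: expo_eq_cis cis_cnj)

lemma expo_mult_cnj: "expo k x * cnj (expo l x) = expo (k - l) x"
  by (simp add: cnj_expo flip: expo_add_left)

lemma continuous_expo: "continuous_on S (expo l)"
  unfolding expo_def by (intro continuous_intros)

lemma borel_measurable_expo [measurable]: "expo l \<in> borel_measurable borel"
  by (intro borel_measurable_continuous_onI continuous_expo)

text \<open>Expanding \<open>z * cnj z\<close> leaves only exponentials at differences of
  frequencies, so integration produces nothing but values of \<open>fourier\<close>.\<close>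

lemma linear_combination_diff_sq:
  "(cmod (expo y x - (\<Sum>l\<in>S. a l * expo l x)))\<^sup>2 =
     Re (1 - (\<Sum>l\<in>S. a l * expo (l - y) x) - (\<Sum>l\<in>S. cnj (a l) * expo (y - l) x)
       + (\<Sum>l\<in>S. \<Sum>m\<in>S. a l * cnj (a m) * expo (l - m) x))"
proof -
  let ?p = "\<Sum>l\<in>S. a l * expo l x"
  have *: "a l * cnj (a m) * expo (l - m) x = (a l * expo l x) * cnj (a m * expo m x)" for l m
    by (simp add: mult_ac flip: expo_mult_cnj)
  have "expo y x * cnj (expo y x) = 1"
    by (simp add: expo_mult_cnj)
  moreover have "?p * cnj (expo y x) = (\<Sum>l\<in>S. a l * expo (l - y) x)"
    by (simp add: sum_distrib_right mult.assoc flip: expo_mult_cnj)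
  moreover have "expo y x * cnj ?p = (\<Sum>l\<in>S. cnj (a l) * expo (y - l) x)"
    by (simp add: sum_distrib_left mult_ac flip: expo_mult_cnj)
  moreover have "?p * cnj ?p = (\<Sum>l\<in>S. \<Sum>m\<in>S. a l * cnj (a m) * expo (l - m) x)"
    unfolding * cnj_sum sum_product ..
  ultimately have "(expo y x - ?p) * cnj (expo y x - ?p) =
      1 - (\<Sum>l\<in>S. a l * expo (l - y) x) - (\<Sum>l\<in>S. cnj (a l) * expo (y - l) x)
       + (\<Sum>l\<in>S. \<Sum>m\<in>S. a l * cnj (a m) * expo (l - m) x)"
    by (simp only: complex_cnj_diff left_diff_distrib right_diff_distrib) (simp add: algebra_simps)
  then show ?thesis
    by (metis Re_complex_of_real complex_norm_square)
qed

section \<open>Spectra and Parseval's identity for Borel probability measures\<close>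

locale borel_prob_space = prob_space M for M :: "(real^'n) measure" +
  assumes sets_eq_borel [measurable_cong, simp]: "sets M = sets borel"
begin

lemma integrable_expo [simp]: "integrable M (expo l)"
  by (rule integrable_const_bound[where B = 1]) auto

lemma square_integrable_expo: "square_integrable M (expo l)"
  by (simp add: square_integrable_def)

lemma L2_norm_expo [simp]: "L2_norm M (expo l) = 1"
  by (simp add: L2_norm_def prob_space)

lemma L2_inner_expo: "L2_inner M (expo k) (expo l) = fourier M (k - l)"
  by (simp add: L2_inner_def fourier_def expo_mult_cnj)

lemma fourier_zero [simp]: "fourier M 0 = 1"
  by (simp add: fourier_def prob_space)

lemma fourier_minus: "fourier M (- l) = cnj (fourier M l)"
  by (simp add: fourier_def flip: cnj_expo)

lemma norm_fourier_minus: "cmod (fourier M (- l)) = cmod (fourier M l)"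
  by (simp add: fourier_minus)

lemma integrable_diff_sq:
  "integrable M (\<lambda>x. (cmod (expo y x - (\<Sum>l\<in>S. a l * expo l x)))\<^sup>2)"
  unfolding linear_combination_diff_sq by (intro integrable_Re) simp

text \<open>Orthogonality removes the off-diagonal terms; completing the square in each
  \<open>a l\<close> then shows that the best choice is the Fourier coefficient
  \<open>fourier M (y - l)\<close> of \<open>expo y\<close>.\<close>

lemma integral_diff_sq:
  assumes orth: "\<And>k l. k \<in> S \<Longrightarrow> l \<in> S \<Longrightarrow> k \<noteq> l \<Longrightarrow> fourier M (k - l) = 0" and "finite S"
  shows "(LINT x|M. (cmod (expo y x - (\<Sum>l\<in>S. a l * expo l x)))\<^sup>2) =
     1 - (\<Sum>l\<in>S. (cmod (fourier M (y - l)))\<^sup>2) + (\<Sum>l\<in>S. (cmod (a l - fourier M (y - l)))\<^sup>2)"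
proof -
  let ?t = "\<lambda>l. fourier M (y - l)"
  have conj: "fourier M (l - y) = cnj (?t l)" for l
    using fourier_minus[of "y - l"] by simp
  have diag: "(\<Sum>m\<in>S. a l * cnj (a m) * fourier M (l - m)) = a l * cnj (a l)" if "l \<in> S" for l
  proof -
    have "(\<Sum>m\<in>S. a l * cnj (a m) * fourier M (l - m)) = (\<Sum>m\<in>S. if m = l then a l * cnj (a l) else 0)"
      using orth that by (intro sum.cong) auto
    then show ?thesis using that \<open>finite S\<close> by simp
  qed
  have "(LINT x|M. (cmod (expo y x - (\<Sum>l\<in>S. a l * expo l x)))\<^sup>2) =
      Re (1 - (\<Sum>l\<in>S. a l * fourier M (l - y)) - (\<Sum>l\<in>S. cnj (a l) * ?t l)
       + (\<Sum>l\<in>S. \<Sum>m\<in>S. a l * cnj (a m) * fourier M (l - m)))"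
    unfolding linear_combination_diff_sq
    by (subst integral_Re) (simp_all add: fourier_def prob_space)
  also have "\<dots> = Re (1 + (\<Sum>l\<in>S. a l * cnj (a l) - a l * cnj (?t l) - cnj (a l) * ?t l))"
    by (intro arg_cong[of _ _ Re]) (simp add: diag conj sum_subtractf)
  also have "\<dots> = 1 + (\<Sum>l\<in>S. Re (a l * cnj (a l) - a l * cnj (?t l) - cnj (a l) * ?t l))"
    by simp
  also have "\<dots> = 1 + (\<Sum>l\<in>S. (cmod (a l - ?t l))\<^sup>2 - (cmod (?t l))\<^sup>2)"
    by (intro arg_cong2[of _ _ _ _ "(+)"] sum.cong refl)
       (simp only: cmod_power2, simp add: power2_eq_square algebra_simps)
  finally show ?thesis
    by (simp add: sum_subtractf)
qed

text \<open>Bessel's inequality bounds the finite sums by 1, and approximating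
  \<open>expo (- y)\<close> by basis members brings them arbitrarily close to 1.\<close>

lemma parseval_if_spectrum:
  assumes "has_spectrum M \<Lambda>"
  shows "((\<lambda>l. (cmod (fourier M (y + l)))\<^sup>2) has_sum 1) \<Lambda>"
proof -
  let ?f = "\<lambda>l. (cmod (fourier M (y + l)))\<^sup>2"
  \<comment> \<open>The arguments \<open>- y - l\<close> produced by \<open>integral_diff_sq\<close>
    are the negatives of \<open>y + l\<close>, and the modulus ignores the sign.\<close>
  have f_eq: "?f l = (cmod (fourier M (- y - l)))\<^sup>2" for l
    using norm_fourier_minus[of "y + l"] by simp
  have orth: "fourier M (k - l) = 0" if "k \<in> \<Lambda>" "l \<in> \<Lambda>" "k \<noteq> l" for k l
    using assms that by (simp add: has_spectrum_def orthogonal_basis_L2_def L2_inner_expo)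
  have dist: "(LINT x|M. (cmod (expo (- y) x - (\<Sum>l\<in>S. a l * expo l x)))\<^sup>2) =
     1 - sum ?f S + (\<Sum>l\<in>S. (cmod (a l - fourier M (- y - l)))\<^sup>2)" if "finite S" "S \<subseteq> \<Lambda>" for S a
    unfolding f_eq by (rule integral_diff_sq) (use orth that in auto)
  have le: "sum ?f S \<le> 1" if "finite S" "S \<subseteq> \<Lambda>" for S
  proof -
    \<comment> \<open>With the Fourier coefficients as \<open>a\<close> the last sum in
      \<open>dist\<close> vanishes, which leaves Bessel's inequality.\<close>
    have "0 \<le> (LINT x|M. (cmod (expo (- y) x - (\<Sum>l\<in>S. fourier M (- y - l) * expo l x)))\<^sup>2)"
      by simp
    then show ?thesis
      using dist[OF that, of "\<lambda>l. fourier M (- y - l)"] by simp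
  qed
  have ge: "\<exists>S. finite S \<and> S \<subseteq> \<Lambda> \<and> 1 - e < sum ?f S" if "e > 0" for e
  proof -
    \<comment> \<open>\<open>L2_norm\<close> is a square root, so the tolerance
      \<open>sqrt e\<close> bounds the squared error by \<open>e\<close>.\<close>
    obtain S a where S: "finite S" "S \<subseteq> \<Lambda>"
        "L2_norm M (\<lambda>x. expo (- y) x - (\<Sum>l\<in>S. a l * expo l x)) < sqrt e"
      using assms square_integrable_expo[of "- y"] \<open>e > 0\<close>
      unfolding has_spectrum_def orthogonal_basis_L2_def by (meson real_sqrt_gt_zero)
    then have "1 - sum ?f S + (\<Sum>l\<in>S. (cmod (a l - fourier M (- y - l)))\<^sup>2) < e"
      by (simp add: L2_norm_def flip: dist)
    moreover have "(\<Sum>l\<in>S. (cmod (a l - fourier M (- y - l)))\<^sup>2) \<ge> 0"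
      by (intro sum_nonneg) auto
    ultimately have "1 - e < sum ?f S" by linarith
    with S show ?thesis by blast
  qed
  show ?thesis
    unfolding has_sum_def
  proof (rule order_tendstoI)
    fix c :: real assume "c < 1"
    then obtain S where S: "finite S" "S \<subseteq> \<Lambda>" "c < sum ?f S"
      using ge[of "1 - c"] by auto
    show "\<forall>\<^sub>F T in finite_subsets_at_top \<Lambda>. c < sum ?f T"
      unfolding eventually_finite_subsets_at_top
    proof (intro exI[of _ S] conjI allI impI)
      fix T assume "finite T \<and> S \<subseteq> T \<and> T \<subseteq> \<Lambda>"
      then have "sum ?f S \<le> sum ?f T" by (intro sum_mono2) auto
      with S show "c < sum ?f T" by linarith
    qed (use S in auto)
  next
    fix c :: real assume "1 < c"
    then show "\<forall>\<^sub>F T in finite_subsets_at_top \<Lambda>. sum ?f T < c"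
      by (intro eventually_finite_subsets_at_top_weakI) (use le in force)
  qed
qed

text \<open>By \<open>dense\<close> it suffices to approximate single exponentials from
  \<open>\<Lambda>\<close>, and the squared error for \<open>expo t\<close> is the amount by which a
  finite Parseval sum falls short of 1.\<close>

lemma spectrum_if_parseval:
  assumes parseval: "\<And>y. ((\<lambda>l. (cmod (fourier M (y + l)))\<^sup>2) has_sum 1) \<Lambda>"
    and dense: "\<And>f e. square_integrable M f \<Longrightarrow> e > 0 \<Longrightarrow>
      \<exists>T c. finite T \<and> L2_norm M (\<lambda>x. f x - (\<Sum>t\<in>T. c t * expo t x)) < e"
  shows "has_spectrum M \<Lambda>"
proof -
  have orth: "fourier M (k - l) = 0" if "k \<in> \<Lambda>" "l \<in> \<Lambda>" "k \<noteq> l" for k l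
  proof -
    \<comment> \<open>At the point \<open>- l\<close> the term \<open>m = l\<close> alone
      contributes 1, which leaves 0 for \<open>m = k\<close>.\<close>
    have "(\<Sum>m\<in>{k, l}. (cmod (fourier M (- l + m)))\<^sup>2) \<le> 1"
      by (rule finite_sum_le_has_sum[OF parseval]) (use that in auto)
    then show ?thesis using that by simp
  qed
  have "\<exists>S c. finite S \<and> S \<subseteq> \<Lambda> \<and> L2_norm M (\<lambda>x. f x - (\<Sum>l\<in>S. c l * expo l x)) < e"
    if f: "square_integrable M f" and e: "e > 0" for f e
  proof -
    obtain T c where T: "finite T" "L2_norm M (\<lambda>x. f x - (\<Sum>t\<in>T. c t * expo t x)) < e / 2"
      using dense[OF f, of "e / 2"] e by auto
    define g where "g x = (\<Sum>t\<in>T. c t * expo t x)" for x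
    define C where "C = (\<Sum>t\<in>T. (cmod (c t))\<^sup>2)"
    \<comment> \<open>Chosen so that \<open>C * card T * d \<le> e\<^sup>2 / 4\<close>; the added
      ones keep the denominator positive when \<open>T\<close> is empty or all \<open>c t\<close>
      vanish.\<close>
    define d where "d = e\<^sup>2 / (4 * (C + 1) * (card T + 1))"
    have "C \<ge> 0" by (auto simp: C_def intro: sum_nonneg)
    have "d > 0" using \<open>C \<ge> 0\<close> e by (simp add: d_def)
    have "\<forall>\<^sub>F S in finite_subsets_at_top \<Lambda>. \<forall>t\<in>T. 1 - d < (\<Sum>l\<in>S. (cmod (fourier M (- t + l)))\<^sup>2)"
    proof (intro eventually_ball_finite ballI \<open>finite T\<close>)
      fix t show "\<forall>\<^sub>F S in finite_subsets_at_top \<Lambda>. 1 - d < (\<Sum>l\<in>S. (cmod (fourier M (- t + l)))\<^sup>2)"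
        using parseval[of "- t"] \<open>d > 0\<close> unfolding has_sum_def by (intro order_tendstoD) auto
    qed
    \<comment> \<open>As \<open>T\<close> is finite, one finite \<open>S\<close> serves all its
      members at once.\<close>
    then obtain S where S: "finite S" "S \<subseteq> \<Lambda>"
        "\<And>t. t \<in> T \<Longrightarrow> 1 - d < (\<Sum>l\<in>S. (cmod (fourier M (- t + l)))\<^sup>2)"
      unfolding eventually_finite_subsets_at_top by (metis order_refl)
    \<comment> \<open>The residual of the orthogonal projection of \<open>expo t\<close> onto the
      span of the exponentials in \<open>S\<close>.\<close>
    define r where "r t x = expo t x - (\<Sum>l\<in>S. fourier M (t - l) * expo l x)" for t x
    have r: "(LINT x|M. (cmod (r t x))\<^sup>2) < d" if "t \<in> T" for t
    proof -
      have "(LINT x|M. (cmod (r t x))\<^sup>2) = 1 - (\<Sum>l\<in>S. (cmod (fourier M (t - l)))\<^sup>2)"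
        unfolding r_def by (subst integral_diff_sq) (use orth S in auto)
      moreover have "cmod (fourier M (t - l)) = cmod (fourier M (- t + l))" for l
        using norm_fourier_minus[of "t - l"] by simp
      ultimately show ?thesis using S(3)[OF that] by simp
    qed
    have int_r: "integrable M (\<lambda>x. (cmod (r t x))\<^sup>2)" for t
      unfolding r_def by (rule integrable_diff_sq)
    \<comment> \<open>These are the Fourier coefficients of \<open>g\<close>, so \<open>h\<close> is
      the projection of \<open>g\<close> onto the same span.\<close>
    define a where "a l = (\<Sum>t\<in>T. c t * fourier M (t - l))" for l
    define h where "h x = (\<Sum>l\<in>S. a l * expo l x)" for x
    have gh: "g x - h x = (\<Sum>t\<in>T. c t * r t x)" for x
    proof -
      have "h x = (\<Sum>t\<in>T. \<Sum>l\<in>S. c t * fourier M (t - l) * expo l x)"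
        unfolding h_def a_def sum_distrib_right by (rule sum.swap)
      then show ?thesis
        by (simp add: g_def r_def right_diff_distrib sum_subtractf sum_distrib_left mult.assoc)
    qed
    \<comment> \<open>Cauchy-Schwarz over \<open>T\<close> separates the coefficients from the
      residuals, whose squared norms are below \<open>d\<close>.\<close>
    have gh_le: "(cmod (g x - h x))\<^sup>2 \<le> C * (\<Sum>t\<in>T. (cmod (r t x))\<^sup>2)" for x
    proof -
      have "cmod (g x - h x) \<le> (\<Sum>t\<in>T. cmod (c t) * cmod (r t x))"
        unfolding gh by (rule sum_norm_le) (simp add: norm_mult)
      then have "(cmod (g x - h x))\<^sup>2 \<le> (\<Sum>t\<in>T. cmod (c t) * cmod (r t x))\<^sup>2"
        by (intro power_mono) auto
      also have "\<dots> \<le> C * (\<Sum>t\<in>T. (cmod (r t x))\<^sup>2)"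
        unfolding C_def by (rule Cauchy_Schwarz_ineq_sum)
      finally show ?thesis .
    qed
    have meas [measurable]: "f \<in> borel_measurable M" "g \<in> borel_measurable M" "h \<in> borel_measurable M"
      using f unfolding g_def h_def square_integrable_def by auto
    have int_gh: "integrable M (\<lambda>x. (cmod (g x - h x))\<^sup>2)"
      by (rule Bochner_Integration.integrable_bound[of _ "\<lambda>x. C * (\<Sum>t\<in>T. (cmod (r t x))\<^sup>2)"])
         (use int_r gh_le \<open>C \<ge> 0\<close> in \<open>auto intro!: AE_I2 simp: abs_of_nonneg sum_nonneg\<close>)
    have sq_add: "(cmod (u + v))\<^sup>2 \<le> 2 * (cmod u)\<^sup>2 + 2 * (cmod v)\<^sup>2" for u v
    proof -
      have "(cmod (u + v))\<^sup>2 \<le> (cmod u + cmod v)\<^sup>2"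
        by (intro power_mono norm_triangle_ineq) auto
      also have "\<dots> \<le> 2 * (cmod u)\<^sup>2 + 2 * (cmod v)\<^sup>2"
        using sum_squares_bound[of "cmod u" "cmod v"] by (simp add: power2_sum)
      finally show ?thesis .
    qed
    \<comment> \<open>The factors 2 in \<open>sq_add\<close> are harmless: the squared errors of
      \<open>f - g\<close> and \<open>g - h\<close> are at most \<open>e\<^sup>2 / 4\<close> each,
      the first strictly less.\<close>
    have g_bound: "cmod (g x) \<le> (\<Sum>t\<in>T. cmod (c t))" for x
      unfolding g_def by (rule sum_norm_le) (simp add: norm_mult)
    have int_g: "integrable M (\<lambda>x. (cmod (g x))\<^sup>2)"
      by (rule integrable_const_bound[where B = "(\<Sum>t\<in>T. cmod (c t))\<^sup>2"])
         (use g_bound in \<open>auto intro!: AE_I2 power_mono\<close>)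
    have int_fg: "integrable M (\<lambda>x. (cmod (f x - g x))\<^sup>2)"
      by (rule Bochner_Integration.integrable_bound[of _ "\<lambda>x. 2 * (cmod (f x))\<^sup>2 + 2 * (cmod (g x))\<^sup>2"])
         (use f int_g sq_add[of "f _" "- g _"] in \<open>auto intro!: AE_I2 simp: square_integrable_def\<close>)
    have "(LINT x|M. (cmod (f x - h x))\<^sup>2) \<le>
        (LINT x|M. 2 * (cmod (f x - g x))\<^sup>2 + 2 * (cmod (g x - h x))\<^sup>2)"
    proof (rule integral_mono')
      fix x show "(cmod (f x - h x))\<^sup>2 \<le> 2 * (cmod (f x - g x))\<^sup>2 + 2 * (cmod (g x - h x))\<^sup>2"
        using sq_add[of "f x - g x" "g x - h x"] by simp
    qed (use int_fg int_gh in auto)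
    also have "\<dots> = 2 * (LINT x|M. (cmod (f x - g x))\<^sup>2) + 2 * (LINT x|M. (cmod (g x - h x))\<^sup>2)"
      using int_fg int_gh by simp
    also have "(LINT x|M. (cmod (g x - h x))\<^sup>2) \<le> (LINT x|M. C * (\<Sum>t\<in>T. (cmod (r t x))\<^sup>2))"
      by (rule integral_mono) (use int_gh int_r gh_le in auto)
    also have "\<dots> = C * (\<Sum>t\<in>T. LINT x|M. (cmod (r t x))\<^sup>2)"
      using int_r by simp
    also have "\<dots> \<le> C * (\<Sum>t\<in>T. d)"
      using r \<open>C \<ge> 0\<close> by (intro mult_left_mono sum_mono) (auto intro: less_imp_le)
    also have "\<dots> \<le> (C + 1) * ((card T + 1) * d)"
      using \<open>C \<ge> 0\<close> \<open>d > 0\<close> by (intro mult_mono) auto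
    also have "\<dots> = e\<^sup>2 / 4"
      using \<open>C \<ge> 0\<close> by (simp add: d_def divide_simps)
    also have "(LINT x|M. (cmod (f x - g x))\<^sup>2) < (e / 2)\<^sup>2"
      using T(2) e unfolding L2_norm_def g_def[symmetric]
      by (metis half_gt_zero less_eq_real_def real_sqrt_abs abs_of_pos real_sqrt_less_iff)
    finally have "(LINT x|M. (cmod (f x - h x))\<^sup>2) < e\<^sup>2"
      by (simp add: power_divide)
    then have "L2_norm M (\<lambda>x. f x - h x) < e"
      using e by (simp add: L2_norm_def real_less_lsqrt)
    with S show ?thesis unfolding h_def by blast
  qed
  then show ?thesis
    using orth by (simp add: has_spectrum_def orthogonal_basis_L2_def L2_inner_expo square_integrable_expo)
qed

end

section \<open>Trigonometric polynomials and interpolation on finite sets\<close>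

inductive trig_polynomial :: "(real^'n \<Rightarrow> complex) \<Rightarrow> bool" where
  zero: "trig_polynomial (\<lambda>x. 0)"
| add_term: "trig_polynomial f \<Longrightarrow> trig_polynomial (\<lambda>x. f x + c * expo t x)"

text \<open>The inductive form allows repeated frequencies, which keeps the closure properties
  simple; here they are merged into one coefficient function.\<close>

lemma trig_polynomial_eq_sum:
  "trig_polynomial f \<Longrightarrow> \<exists>T c. finite T \<and> (\<forall>x. f x = (\<Sum>t\<in>T. c t * expo t x))"
proof (induction rule: trig_polynomial.induct)
  case zero
  show ?case by (rule exI[of _ "{}"]) simp
next
  case (add_term f a s)
  then obtain T c where T: "finite T" and f: "\<And>x. f x = (\<Sum>t\<in>T. c t * expo t x)" by blast
  \<comment> \<open>The new frequency \<open>s\<close> may already lie in \<open>T\<close>, in which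
    case the coefficients add up; outside \<open>T\<close> the old one counts as 0.\<close>
  define c' where "c' t = (if t \<in> T then c t else 0) + (if t = s then a else 0)" for t
  have "f x + a * expo s x = (\<Sum>t\<in>insert s T. c' t * expo t x)" for x
  proof -
    have "(\<Sum>t\<in>insert s T. c' t * expo t x) = (\<Sum>t\<in>insert s T. if t \<in> T then c t * expo t x else 0)
        + (\<Sum>t\<in>insert s T. if t = s then a * expo s x else 0)"
      unfolding sum.distrib[symmetric] by (intro sum.cong) (auto simp: c'_def distrib_right)
    also have "(\<Sum>t\<in>insert s T. if t \<in> T then c t * expo t x else 0) = f x"
      unfolding f by (rule sum.mono_neutral_cong_right) (use T in auto)
    finally show ?thesis using T by simp
  qed
  then show ?case using T by blast
qed

lemma trig_polynomial_add:
  assumes "trig_polynomial f" "trig_polynomial g"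
  shows "trig_polynomial (\<lambda>x. f x + g x)"
  using assms(2)
proof (induction rule: trig_polynomial.induct)
  case zero
  show ?case using assms(1) by simp
next
  case (add_term g c t)
  show ?case
    using trig_polynomial.add_term[OF add_term.IH, of c t] by (simp only: add.assoc)
qed

lemma trig_polynomial_mult_expo:
  "trig_polynomial f \<Longrightarrow> trig_polynomial (\<lambda>x. c * expo t x * f x)"
proof (induction rule: trig_polynomial.induct)
  case zero
  show ?case by (simp add: trig_polynomial.zero)
next
  case (add_term f a s)
  have "(\<lambda>x. c * expo t x * (f x + a * expo s x)) =
      (\<lambda>x. c * expo t x * f x + (c * a) * expo (t + s) x)"
    by (simp add: expo_add_left algebra_simps)
  then show ?case
    by (simp only: trig_polynomial.add_term[OF add_term.IH])
qed

lemma trig_polynomial_scale: "trig_polynomial f \<Longrightarrow> trig_polynomial (\<lambda>x. c * f x)"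
  using trig_polynomial_mult_expo[of f c 0] by simp

text \<open>A product of factors \<open>(1 + expo t x / expo t b\<^sub>0) / 2\<close>, one for each
  \<open>b\<close> in \<open>B\<close>, with \<open>t\<close> chosen so that the phases at
  \<open>b\<close> and \<open>b\<^sub>0\<close> are opposite.\<close>

lemma trig_polynomial_indicator:
  assumes "finite B" "b\<^sub>0 \<notin> B"
  shows "\<exists>g. trig_polynomial g \<and> g b\<^sub>0 = 1 \<and> (\<forall>b\<in>B. g b = 0)"
  using assms
proof (induction B rule: finite_induct)
  case empty
  show ?case
    using trig_polynomial.add_term[OF trig_polynomial.zero, of 1 0] by auto
next
  case (insert b B)
  then obtain g where g: "trig_polynomial g" "g b\<^sub>0 = 1" "\<And>b. b \<in> B \<Longrightarrow> g b = 0" by auto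
  have "b \<noteq> b\<^sub>0" using insert by auto
  \<comment> \<open>\<open>t\<close> is scaled so that \<open>t \<bullet> (b\<^sub>0 - b) = 1/2\<close>, whence \<open>expo t b = - expo t b\<^sub>0\<close>.\<close>
  define t where "t = (1 / (2 * (norm (b\<^sub>0 - b))\<^sup>2)) *\<^sub>R (b\<^sub>0 - b)"
  have "t \<bullet> (b\<^sub>0 - b) = 1 / 2"
    using \<open>b \<noteq> b\<^sub>0\<close> by (simp add: t_def power2_norm_eq_inner)
  then have "expo t (b\<^sub>0 - b) = - 1"
    by (simp only: expo_eq_cis) simp
  then have "expo t b\<^sub>0 = - expo t b"
    using expo_add_right[of t "b\<^sub>0 - b" b] by simp
  moreover have "expo t x \<noteq> 0" for x
    using norm_expo[of t x] by force
  ultimately have eval: "1 / (2 * expo t b\<^sub>0) * expo t b = - 1 / 2" "1 / (2 * expo t b\<^sub>0) * expo t b\<^sub>0 = 1 / 2"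
    by simp_all
  let ?h = "\<lambda>x. 1 / 2 * g x + 1 / (2 * expo t b\<^sub>0) * expo t x * g x"
  have "trig_polynomial ?h"
    by (intro trig_polynomial_add trig_polynomial_scale trig_polynomial_mult_expo g(1))
  moreover have "?h b\<^sub>0 = 1"
    unfolding eval using g by simp
  moreover have "?h b' = 0" if "b' \<in> insert b B" for b'
  proof (cases "b' = b")
    case True
    show ?thesis unfolding True eval by simp
  qed (use g(3) that in auto)
  ultimately show ?case by blast
qed

text \<open>As in Newton interpolation, the value at a new point is corrected by a multiple of a
  function that vanishes at the old ones.\<close>

lemma trig_polynomial_interpolation:
  assumes "finite B"
  shows "\<exists>g. trig_polynomial g \<and> (\<forall>b\<in>B. g b = f b)"
  using assms
proof (induction B rule: finite_induct)
  case empty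
  show ?case using trig_polynomial.zero by auto
next
  case (insert b\<^sub>0 B)
  then obtain g where g: "trig_polynomial g" "\<And>b. b \<in> B \<Longrightarrow> g b = f b" by auto
  obtain h where h: "trig_polynomial h" "h b\<^sub>0 = 1" "\<And>b. b \<in> B \<Longrightarrow> h b = 0"
    using trig_polynomial_indicator[OF insert(1,2)] by auto
  have "trig_polynomial (\<lambda>x. g x + (f b\<^sub>0 - g b\<^sub>0) * h x)"
    by (intro trig_polynomial_add trig_polynomial_scale g h)
  moreover have "\<forall>b\<in>insert b\<^sub>0 B. g b + (f b\<^sub>0 - g b\<^sub>0) * h b = f b"
    using g h by auto
  ultimately show ?case by blast
qed

section \<open>The normalised counting measure of a finite set\<close>

lemma integral_delta_measure:
  fixes f :: "real^'n \<Rightarrow> 'a::{banach, second_countable_topology}"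
  assumes "finite B" "f \<in> borel_measurable borel"
  shows "(LINT x|delta_measure B. f x) = (1 / card B) *\<^sub>R (\<Sum>b\<in>B. f b)"
  using assms unfolding delta_measure_def uniform_count_measure_def
  by (subst integral_distr)
     (auto simp: measurable_def lebesgue_integral_point_measure_finite scaleR_sum_right)

lemma borel_prob_space_delta_measure:
  assumes "finite B" "B \<noteq> {}"
  shows "borel_prob_space (delta_measure B)"
proof -
  interpret prob_space "uniform_count_measure B"
    using assms by (rule prob_space_uniform_count_measure)
  show ?thesis
    unfolding borel_prob_space_def borel_prob_space_axioms_def delta_measure_def
    by (auto intro!: prob_space_distr simp: measurable_def space_uniform_count_measure)
qed

lemma fourier_delta_measure:
  assumes "finite B"
  shows "fourier (delta_measure B) = delta_hat B"
  unfolding fourier_def delta_hat_def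
  by (simp add: fun_eq_iff integral_delta_measure[OF assms] expo_commute[of _ "_::real^'n"]
      scaleR_conv_of_real)

text \<open>The measure sees only \<open>B\<close>, where interpolation matches \<open>f\<close>
  exactly, so distance 0 is attained.\<close>

lemma dense_delta_measure:
  assumes "finite B" "square_integrable (delta_measure B) f" "e > 0"
  shows "\<exists>T c. finite T \<and> L2_norm (delta_measure B) (\<lambda>x. f x - (\<Sum>t\<in>T. c t * expo t x)) < e"
proof -
  obtain g where g: "trig_polynomial g" "\<forall>b\<in>B. g b = f b"
    using trig_polynomial_interpolation[OF assms(1)] by blast
  obtain T c where T: "finite T" "\<And>x. g x = (\<Sum>t\<in>T. c t * expo t x)"
    using trig_polynomial_eq_sum[OF g(1)] by blast
  have [measurable]: "f \<in> borel_measurable borel"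
    using assms(2) by (simp add: square_integrable_def delta_measure_def)
  have [measurable]: "g \<in> borel_measurable borel"
  proof -
    have "g = (\<lambda>x. \<Sum>t\<in>T. c t * expo t x)" using T(2) by blast
    then show ?thesis by simp
  qed
  have "L2_norm (delta_measure B) (\<lambda>x. f x - (\<Sum>t\<in>T. c t * expo t x)) = 0"
    unfolding L2_norm_def
    by (subst integral_delta_measure[OF assms(1)]) (use g(2) in \<open>simp_all flip: T(2)\<close>)
  with T(1) assms(3) show ?thesis by metis
qed

section \<open>Expansive matrices and the Fourier transform of the invariant measure\<close>

text \<open>A nonzero real kernel vector, complexified, would be an eigenvector for the eigenvalue
  0.\<close>

lemma expansive_imp_invertible:
  fixes A :: "real^'n^'n"
  assumes "expansive A"
  shows "invertible A"
proof -
  have "v = 0" if "A *v v = 0" for v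
  proof (rule ccontr)
    assume "v \<noteq> 0"
    define w :: "complex^'n" where "w = (\<chi> i. complex_of_real (v $ i))"
    have "w \<noteq> 0"
      using \<open>v \<noteq> 0\<close> by (auto simp: w_def vec_eq_iff)
    moreover have "map_matrix complex_of_real A *v w = 0 *s w"
      using that by (simp add: w_def vec_eq_iff map_matrix_def matrix_vector_mult_def
        flip: of_real_mult of_real_sum)
    ultimately show False
      using assms unfolding expansive_def by fastforce
  qed
  then show ?thesis
    by (metis invertible_left_inverse matrix_left_invertible_ker)
qed

lemma matrix_inv_inverse:
  fixes A :: "real^'n^'n"
  assumes "invertible A"
  shows "A ** matrix_inv A = mat 1" "matrix_inv A ** A = mat 1"
  using someI_ex[OF assms[unfolded invertible_def]] by (simp_all add: matrix_inv_def)

lemma matrix_inv_vector [simp]: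
  fixes A :: "real^'n^'n"
  assumes "invertible A"
  shows "A *v (matrix_inv A *v x) = x" "matrix_inv A *v (A *v x) = x"
  using matrix_inv_inverse[OF assms] by (simp_all add: matrix_vector_mul_assoc)

lemma continuous_on_ifs_map: "continuous_on UNIV (ifs_map A b)"
  unfolding ifs_map_def by (intro continuous_intros linear_continuous_on_compose[OF _ matrix_vector_mul_linear])

lemma expo_ifs_map:
  fixes A :: "real^'n^'n"
  assumes "invertible A"
  shows "expo (transpose A *v u) (ifs_map A b x) = expo u x * expo u b"
proof -
  have "(transpose A *v u) \<bullet> (matrix_inv A *v (x + b)) = u \<bullet> (A *v (matrix_inv A *v (x + b)))"
    by (simp add: transpose_matrix_vector dot_lmul_matrix)
  also have "A *v (matrix_inv A *v (x + b)) = x + b"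
    using assms by simp
  finally have "expo (transpose A *v u) (ifs_map A b x) = expo u (x + b)"
    by (simp only: expo_def ifs_map_def)
  then show ?thesis by (simp only: expo_add_right)
qed

text \<open>Exponentials lack compact support, so they are reached from the defining identity by
  cutting off and dominated convergence.\<close>

lemma invariant_measure_bounded_continuous:
  fixes f :: "real^'n \<Rightarrow> complex"
  assumes "invariant_measure A B \<mu>" and cont: "continuous_on UNIV f" and bound: "\<And>x. cmod (f x) \<le> C"
  shows "(LINT x|\<mu>. f x) = 1 / of_nat (card B) * (\<Sum>b\<in>B. LINT x|\<mu>. f (ifs_map A b x))"
proof -
  interpret borel_prob_space \<mu>
    using assms(1) by (simp add: invariant_measure_def borel_prob_space_def borel_prob_space_axioms_def)
  \<comment> \<open>A continuous cutoff: 1 on the ball of radius \<open>n\<close>, 0 outside the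
    ball of radius \<open>n + 1\<close>.\<close>
  define \<phi> where "\<phi> n x = max 0 (min 1 (real n + 1 - norm x))" for n and x :: "real^'n"
  define g where "g n x = complex_of_real (\<phi> n x) * f x" for n x
  have cont_g: "continuous_on UNIV (g n)" for n
    unfolding g_def \<phi>_def by (intro continuous_intros cont)
  have [measurable]: "f \<in> borel_measurable borel" "g n \<in> borel_measurable borel"
      "ifs_map A b \<in> borel_measurable borel" for n b
    by (intro borel_measurable_continuous_onI cont cont_g continuous_on_ifs_map)+
  have "compact (closure {x. g n x \<noteq> 0})" for n
  proof -
    have "{x. g n x \<noteq> 0} \<subseteq> cball 0 (real n + 1)"
      by (auto simp: g_def \<phi>_def split: if_splits)
    then show ?thesis
      using bounded_subset[OF bounded_cball] by simp
  qed
  then have inv: "(LINT x|\<mu>. g n x) = 1 / of_nat (card B) * (\<Sum>b\<in>B. LINT x|\<mu>. g n (ifs_map A b x))" for n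
    using assms(1) cont_g unfolding invariant_measure_def by blast
  have bound_g: "cmod (g n x) \<le> C" for n x
  proof -
    have "cmod (g n x) \<le> 1 * cmod (f x)"
      unfolding g_def norm_mult by (intro mult_right_mono) (auto simp: \<phi>_def)
    with bound[of x] show ?thesis by simp
  qed
  have lim_g: "(\<lambda>n. g n x) \<longlonglongrightarrow> f x" for x
  proof (rule tendsto_eventually, rule eventually_sequentiallyI)
    fix n assume "nat \<lceil>norm x\<rceil> \<le> n"
    then have "norm x \<le> real n" by linarith
    then show "g n x = f x" by (simp add: g_def \<phi>_def)
  qed
  \<comment> \<open>The inner map \<open>h\<close> covers both sides of the identity: it is the
    identity map on the left and \<open>ifs_map A b\<close> on the right.\<close>
  have lim: "(\<lambda>n. LINT x|\<mu>. g n (h x)) \<longlonglongrightarrow> (LINT x|\<mu>. f (h x))"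
    if [measurable]: "h \<in> borel_measurable borel" for h
    by (rule integral_dominated_convergence[where w = "\<lambda>_. C"])
       (use bound_g lim_g in auto)
  have "(\<lambda>n. LINT x|\<mu>. g n x) \<longlonglongrightarrow> 1 / of_nat (card B) * (\<Sum>b\<in>B. LINT x|\<mu>. f (ifs_map A b x))"
    unfolding inv by (intro tendsto_intros lim) simp
  then show ?thesis
    using lim[of "\<lambda>x. x"] by (simp add: LIMSEQ_unique)
qed

text \<open>Each \<open>ifs_map A b\<close> turns \<open>expo (transpose A *v u)\<close> into
  \<open>expo u\<close> times the phase \<open>expo u b\<close>, and the average of these phases
  over \<open>B\<close> is \<open>delta_hat B u\<close>.\<close>

lemma fourier_invariant_measure:
  fixes A :: "real^'n^'n"
  assumes "invertible A" "invariant_measure A B \<mu>"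
  shows "fourier \<mu> (transpose A *v u) = delta_hat B u * fourier \<mu> u"
proof -
  have "fourier \<mu> (transpose A *v u) =
      1 / of_nat (card B) * (\<Sum>b\<in>B. LINT x|\<mu>. expo (transpose A *v u) (ifs_map A b x))"
    unfolding fourier_def
    by (rule invariant_measure_bounded_continuous[OF assms(2) continuous_expo, where C = 1]) simp
  also have "\<dots> = delta_hat B u * fourier \<mu> u"
    unfolding expo_ifs_map[OF assms(1)] delta_hat_def fourier_def expo_commute[of _ u]
    by (simp add: sum_distrib_left sum_divide_distrib mult.commute)
  finally show ?thesis .
qed

section \<open>Direct sums as bijections, and the factorisation of the Parseval sum\<close>

text \<open>Injectivity of \<open>h\<close> lets \<open>p\<close> stand for \<open>h p\<close>, so
  sums over \<open>R\<close> become double sums by reindexing. \<open>Q\<close> comes first because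
  it will index the outer sum.\<close>

lemma is_direct_sum_image_iff:
  assumes "inj h"
  shows "is_direct_sum (h ` P) Q R \<longleftrightarrow> bij_betw (\<lambda>(q, p). h p + q) (Q \<times> P) R"
proof -
  have R: "h ` P + Q = (\<lambda>(q, p). h p + q) ` (Q \<times> P)"
    by (auto simp: set_plus_def)
  show ?thesis
  proof
    assume *: "is_direct_sum (h ` P) Q R"
    have "inj_on (\<lambda>(q, p). h p + q) (Q \<times> P)"
    proof (clarsimp simp: inj_on_def)
      fix q p q' p' assume pq: "q \<in> Q" "p \<in> P" "q' \<in> Q" "p' \<in> P" "h p + q = h p' + q'"
      then have "h p + q \<in> R"
        using * by (auto simp: is_direct_sum_def)
      then have "\<exists>!z. z \<in> h ` P \<times> Q \<and> h p + q = fst z + snd z"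
        using * unfolding is_direct_sum_def by blast
      then have "(h p, q) = (h p', q')"
        by (rule ex1E) (metis pq imageI mem_Times_iff fst_conv snd_conv)
      then show "q = q' \<and> p = p'"
        using assms by (simp add: inj_eq)
    qed
    then show "bij_betw (\<lambda>(q, p). h p + q) (Q \<times> P) R"
      using * R by (simp add: is_direct_sum_def bij_betw_def)
  next
    assume *: "bij_betw (\<lambda>(q, p). h p + q) (Q \<times> P) R"
    have "\<exists>!z. z \<in> h ` P \<times> Q \<and> r = fst z + snd z" if "r \<in> R" for r
    proof -
      obtain q p where pq: "q \<in> Q" "p \<in> P" "r = h p + q"
        using * \<open>r \<in> R\<close> by (auto simp: bij_betw_def)
      show ?thesis
      proof (rule ex1I)
        fix z assume z: "z \<in> h ` P \<times> Q \<and> r = fst z + snd z"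
        then obtain q' p' where pq': "q' \<in> Q" "p' \<in> P" "z = (h p', q')" by auto
        then have "(q', p') = (q, p)"
          using * pq z by (intro inj_onD[of "\<lambda>(q, p). h p + q" "Q \<times> P"]) (auto simp: bij_betw_def)
        then show "z = (h p, q)" using pq' by simp
      qed (use pq in auto)
    qed
    then show "is_direct_sum (h ` P) Q R"
      using * R by (simp add: is_direct_sum_def bij_betw_def)
  qed
qed

theorem lemma3p33:
  fixes A :: "real^'d^'d" and B \<Lambda> :: "(real^'d) set" and \<mu> :: "(real^'d) measure"
  assumes "integer_matrix A" and "expansive A"
    and "finite B"
    and "invariant_measure A B \<mu>"
    and "has_spectrum \<mu> \<Lambda>"
    and "\<forall>l\<in>\<Lambda>. \<forall>x. delta_hat B (x + l) = delta_hat B x"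
  shows "(\<forall>L :: (real^'d) set.
            has_spectrum (delta_measure B) ((*v) (matrix_inv (transpose A)) ` L) \<longrightarrow>
            (\<exists>\<Lambda>'. is_direct_sum ((*v) (transpose A) ` \<Lambda>) L \<Lambda>' \<and> has_spectrum \<mu> \<Lambda>')) \<and>
         (\<forall>L :: (real^'d) set.
            is_direct_sum ((*v) (transpose A) ` \<Lambda>) L \<Lambda> \<longrightarrow>
            has_spectrum (delta_measure B) ((*v) (matrix_inv (transpose A)) ` L))"
proof -
  interpret \<mu>: borel_prob_space \<mu>
    using assms(4) by (simp add: invariant_measure_def borel_prob_space_def borel_prob_space_axioms_def)
  have "invertible A"
    using assms(2) by (rule expansive_imp_invertible)
  have dilate: "fourier \<mu> (transpose A *v u) = delta_hat B u * fourier \<mu> u" for u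
    using \<open>invertible A\<close> assms(4) by (rule fourier_invariant_measure)
  \<comment> \<open>At 0 the dilation identity reads \<open>1 = delta_hat B 0\<close>, whereas
    \<open>delta_hat {} 0 = 0\<close>.\<close>
  have "B \<noteq> {}"
    using dilate[of 0] by (auto simp: delta_hat_def)
  then interpret \<delta>: borel_prob_space "delta_measure B"
    by (intro borel_prob_space_delta_measure assms(3))
  note [simp] = fourier_delta_measure[OF assms(3)]
  define S where "S = (*v) (transpose A)"
  define S' where "S' = (*v) (matrix_inv (transpose A))"
  have "invertible (transpose A)"
    using \<open>invertible A\<close> by (metis invertible_left_inverse invertible_right_inverse left_invertible_transpose)
  then have inverse [simp]: "S (S' x) = x" "S' (S x) = x" for x
    by (simp_all add: S_def S'_def del: transpose_matrix_vector)
  have S_add: "S (x + y) = S x + S y" for x y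
    by (simp add: S_def matrix_vector_right_distrib)
  have inj: "inj S" "inj_on S' L" for L
    by (metis inverse(2) injI, metis inverse(1) inj_onI)
  \<comment> \<open>\<open>?F\<close> holds the Parseval terms of \<open>\<mu>\<close> over pairs
    from \<open>L\<close> and \<open>\<Lambda>\<close>, \<open>?G\<close> those of \<open>B\<close>
    over \<open>L\<close>.\<close>
  let ?F = "\<lambda>y (l, k). (cmod (fourier \<mu> (y + (S k + l))))\<^sup>2"
  let ?G = "\<lambda>y l. (cmod (delta_hat B (y + S' l)))\<^sup>2"
  \<comment> \<open>Dilation splits off a factor \<open>delta_hat B\<close>, periodicity makes it
    independent of \<open>k\<close>, and the remaining sum over \<open>\<Lambda>\<close> is 1 by
    Parseval for \<open>\<mu>\<close>.\<close>
  have inner_sum: "((\<lambda>k. ?F y (l, k)) has_sum ?G (S' y) l) \<Lambda>" for y l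
  proof -
    have "?F y (l, k) = ?G (S' y) l * (cmod (fourier \<mu> (S' y + S' l + k)))\<^sup>2" if "k \<in> \<Lambda>" for k
    proof -
      have "y + (S k + l) = S (S' y + S' l + k)"
        by (simp add: S_add)
      then have "fourier \<mu> (y + (S k + l)) = delta_hat B (S' y + S' l) * fourier \<mu> (S' y + S' l + k)"
        using dilate assms(6) that by (simp add: S_def)
      then show ?thesis by (simp add: norm_mult power_mult_distrib)
    qed
    moreover have "((\<lambda>k. ?G (S' y) l * (cmod (fourier \<mu> (S' y + S' l + k)))\<^sup>2) has_sum ?G (S' y) l) \<Lambda>"
      using has_sum_cmult_right[OF \<mu>.parseval_if_spectrum[OF assms(5), of "S' y + S' l"]] by simp
    ultimately show ?thesis by (simp cong: has_sum_cong)
  qed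
  have outer_reindex: "(?G y has_sum 1) L \<longleftrightarrow>
      ((\<lambda>g. (cmod (fourier (delta_measure B) (y + g)))\<^sup>2) has_sum 1) (S' ` L)" for y L
    by (simp add: has_sum_reindex[OF inj(2)] o_def)
  have "\<exists>\<Lambda>'. is_direct_sum (S ` \<Lambda>) L \<Lambda>' \<and> has_spectrum \<mu> \<Lambda>'"
    if "has_spectrum (delta_measure B) (S' ` L)" for L
  proof -
    \<comment> \<open>The terms are nonnegative, so convergence of the iterated sum gives joint
      summability with the same value.\<close>
    have sum_F: "(?F y has_sum 1) (L \<times> \<Lambda>)" for y
    proof (rule has_sum_SigmaI)
      show "(?G (S' y) has_sum 1) L"
        unfolding outer_reindex by (rule \<delta>.parseval_if_spectrum) fact
      then show "?F y summable_on L \<times> \<Lambda>"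
        by (intro summable_on_SigmaI[OF inner_sum]) (auto simp: summable_on_def)
    qed (rule inner_sum)
    \<comment> \<open>Two pairs with the same value of \<open>S k + l\<close> would, at
      \<open>y\<close> equal to minus that value, each contribute 1 to a sum of total 1.\<close>
    have "inj_on (\<lambda>(l, k). S k + l) (L \<times> \<Lambda>)"
    proof (rule inj_onI, rule ccontr)
      fix p q assume pq: "p \<in> L \<times> \<Lambda>" "q \<in> L \<times> \<Lambda>" "p \<noteq> q"
        "(case p of (l, k) \<Rightarrow> S k + l) = (case q of (l, k) \<Rightarrow> S k + l)"
      define y where "y = - (case p of (l, k) \<Rightarrow> S k + l)"
      have "?F y p = 1" "?F y q = 1"
        using pq(4) by (auto simp: y_def split: prod.splits)
      moreover have "sum (?F y) {p, q} \<le> 1"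
        by (rule finite_sum_le_has_sum[OF sum_F]) (use pq in auto)
      ultimately show False using pq(3) by simp
    qed
    then have bij: "bij_betw (\<lambda>(l, k). S k + l) (L \<times> \<Lambda>) ((\<lambda>(l, k). S k + l) ` (L \<times> \<Lambda>))"
      (is "bij_betw _ _ ?\<Lambda>'") by (rule inj_on_imp_bij_betw)
    have "has_spectrum \<mu> ?\<Lambda>'"
    proof (rule \<mu>.spectrum_if_parseval)
      show "((\<lambda>l. (cmod (fourier \<mu> (y + l)))\<^sup>2) has_sum 1) ?\<Lambda>'" for y
        unfolding has_sum_reindex_bij_betw[OF bij, symmetric]
        using sum_F[of y] by (simp add: case_prod_unfold)
      \<comment> \<open>Finite combinations over \<open>\<Lambda>\<close> already approximate
        \<open>f\<close>, by the assumed spectrum.\<close>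
      show "\<exists>T c. finite T \<and> L2_norm \<mu> (\<lambda>x. f x - (\<Sum>t\<in>T. c t * expo t x)) < e"
        if "square_integrable \<mu> f" "e > 0" for f e
        using assms(5) that unfolding has_spectrum_def orthogonal_basis_L2_def by meson
    qed
    with bij show ?thesis
      unfolding is_direct_sum_image_iff[OF inj(1)] by blast
  qed
  moreover have "has_spectrum (delta_measure B) (S' ` L)"
    if "is_direct_sum (S ` \<Lambda>) L \<Lambda>" for L
  proof (rule \<delta>.spectrum_if_parseval)
    fix y
    have bij: "bij_betw (\<lambda>(l, k). S k + l) (L \<times> \<Lambda>) \<Lambda>"
      using that by (simp add: is_direct_sum_image_iff[OF inj(1)])
    \<comment> \<open>The base point \<open>S y\<close> is taken because \<open>S'\<close> carries
      it back to \<open>y\<close>; summing over \<open>\<Lambda>\<close> first then leaves the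
      Parseval sum of \<open>B\<close> at \<open>y\<close>.\<close>
    have "(?F (S y) has_sum 1) (L \<times> \<Lambda>)"
      using \<mu>.parseval_if_spectrum[OF assms(5), of "S y"]
      unfolding has_sum_reindex_bij_betw[OF bij, symmetric] by (simp add: case_prod_unfold)
    then have "(?G (S' (S y)) has_sum 1) L"
      by (rule has_sum_SigmaD) (rule inner_sum)
    then show "((\<lambda>g. (cmod (fourier (delta_measure B) (y + g)))\<^sup>2) has_sum 1) (S' ` L)"
      unfolding outer_reindex by simp
  qed (rule dense_delta_measure[OF assms(3)])
  ultimately show ?thesis
    unfolding S_def S'_def by blast
qed

end
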